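(* Let $b,c$ be positive integers with $bc\ge 4$, and let $\lambda=(\lambda_0,\lambda_1)\in\mathbb{Z}^2$. If $\lambda$ lies outside of the imaginary cone $\mathcal{I}$, then the dominance region $\mathcal{P}_\lambda$ is the single point $\{\lambda\}$. Otherwise, $\mathcal{P}_\lambda$ is the polygon consisting of those $\mu=(\mu_0,\mu_1)\in\mathbb{R}^2$ satisfying all of the following inequalities: \[ \begin{array}{rcccl} 0 & \le & \frac{bc-\sqrt{bc(bc-4)}}{2b}(\mu_0-\lambda_0)+(\mu_1-\lambda_1) & \le & -c\lambda_0-\frac{bc+\sqrt{bc(bc-4)}}{2b}\,b\lambda_1;\\[4pt] 0 & \le & -\frac{bc-\sqrt{bc(bc-4)}}{2b}(\mu_0-\lambda_0)+(\mu_1-\lambda_1) & \le & c\lambda_0;\\[4pt] 0 & \le & -(\mu_0-\lambda_0)-\frac{bc-\sqrt{bc(bc-4)}}{2c}(\mu_1-\lambda_1) & \le & \frac{bc+\sqrt{bc(bc-4)}}{2c}\,c\lambda_0+b\lambda_1;\\[4pt] 0 & \le & -(\mu_0-\lambda_0)+\frac{bc-\sqrt{bc(bc-4)}}{2c}(\mu_1-\lambda_1) & \le & -b\lambda_1. \end{array} \]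
   Context: Fix positive integers $b,c$ with $bc\ge4$. The imaginary cone $\mathcal{I}\subset\mathbb{R}^2$ is the closed cone positively spanned by the two vectors $\big(2b,-bc\pm\sqrt{bc(bc-4)}\big)$. Let $\phi_0$ be the identity of $\mathbb{R}^2$ and define piecewise-linear bijections $\phi_{\pm1}:\mathbb{R}^2\to\mathbb{R}^2$ by $\phi_1(\lambda)=(-\lambda_0,c\lambda_0+\lambda_1)$ if $\lambda_0\ge0$ and $\phi_1(\lambda)=(-\lambda_0,\lambda_1)$ if $\lambda_0<0$; $\phi_{-1}(\lambda)=(\lambda_0,-\lambda_1)$ if $\lambda_1\ge0$ and $\phi_{-1}(\lambda)=(\lambda_0+b\lambda_1,-\lambda_1)$ if $\lambda_1<0$. For $k\in\mathbb{Z}$ with $|k|>1$ put $\phi_k=(\phi_{-1}^{-1}\phi_1)^j$ if $k=2j$ and $\phi_k=\phi_1(\phi_{-1}^{-1}\phi_1)^j$ if $k=2j+1$ (negative powers meaning powers of the inverse). For $\lambda\in\mathbb{R}^2$ and $k\in\mathbb{Z}$ let $\mathcal{C}_k(\lambda)=\{(\lambda_0-r,\lambda_1+s):r,s\in\mathbb{R}_{\ge0}\}$ if $k$ is even and $\mathcal{C}_k(\lambda)=\{(\lambda_0+r,\lambda_1-s):r,s\in\mathbb{R}_{\ge0}\}$ if $k$ is odd. For $\lambda\in\mathbb{Z}^2$ the dominance region is $\mathcal{P}_\lambda=\bigcap_{k\in\mathbb{Z}}\phi_k^{-1}\mathcal{C}_k(\phi_k\lambda)\subseteq\mathbb{R}^2$.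 *)

theory Defs
  imports "HOL-Analysis.Analysis"
begin

definition disc_root :: "nat \<Rightarrow> nat \<Rightarrow> real" where
  "disc_root b c = sqrt (real b * real c * (real b * real c - 4))"

text \<open>The convex cone hull of a finite set consists of the nonnegative linear combinations of
  its elements; it contains the origin and is closed.\<close>

definition imaginary_cone :: "nat \<Rightarrow> nat \<Rightarrow> (real \<times> real) set" where
  "imaginary_cone b c = convex_cone hull
     {(2 * real b, - (real b * real c) + disc_root b c),
      (2 * real b, - (real b * real c) - disc_root b c)}"

definition phi_pos :: "nat \<Rightarrow> real \<times> real \<Rightarrow> real \<times> real" where
  "phi_pos c = (\<lambda>(x, y). if x \<ge> 0 then (- x, real c * x + y) else (- x, y))"

definition phi_neg :: "nat \<Rightarrow> real \<times> real \<Rightarrow> real \<times> real" where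
  "phi_neg b = (\<lambda>(x, y). if y \<ge> 0 then (x, - y) else (x + real b * y, - y))"

text \<open>Integer powers of a map under composition; meaningful only when \<open>f\<close> is a bijection.\<close>

definition int_funpow :: "('a \<Rightarrow> 'a) \<Rightarrow> int \<Rightarrow> 'a \<Rightarrow> 'a" where
  "int_funpow f j = (if j \<ge> 0 then f ^^ nat j else inv f ^^ nat (- j))"

text \<open>The integer division \<open>k div 2\<close> rounds down, so it is \<open>j\<close> both for \<open>k = 2 * j\<close> and
  for \<open>k = 2 * j + 1\<close>, also when \<open>k\<close> is negative.\<close>

definition phi :: "nat \<Rightarrow> nat \<Rightarrow> int \<Rightarrow> real \<times> real \<Rightarrow> real \<times> real" where
  "phi b c k =
     (if k = 0 then id
      else if k = 1 then phi_pos c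
      else if k = - 1 then phi_neg b
      else if even k then int_funpow (inv (phi_neg b) \<circ> phi_pos c) (k div 2)
      else phi_pos c \<circ> int_funpow (inv (phi_neg b) \<circ> phi_pos c) (k div 2))"

definition quadrant :: "int \<Rightarrow> real \<times> real \<Rightarrow> (real \<times> real) set" where
  "quadrant k l =
     (if even k then {(fst l - r, snd l + s) | r s. r \<ge> 0 \<and> s \<ge> 0}
      else {(fst l + r, snd l - s) | r s. r \<ge> 0 \<and> s \<ge> 0})"

definition dominance_region :: "nat \<Rightarrow> nat \<Rightarrow> real \<times> real \<Rightarrow> (real \<times> real) set" where
  "dominance_region b c l = (\<Inter>k. phi b c k -` quadrant k (phi b c k l))"

lemma bij_phi_pos: "bij (phi_pos c)"
  by (rule bij_betw_byWitness[where f' = "\<lambda>(x, y). if x \<le> 0 then (- x, y + real c * x) else (- x, y)"])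
     (auto simp: phi_pos_def)

lemma bij_phi_neg: "bij (phi_neg b)"
  by (rule bij_betw_byWitness[where f' = "\<lambda>(x, y). if y \<le> 0 then (x, - y) else (x + real b * y, - y)"])
     (auto simp: phi_neg_def)

end

theory Submission
  imports Defs
begin

text \<open>Up to sign and rescaling by \<open>sqrt b\<close> and \<open>sqrt c\<close>, the coordinates of the points
  \<open>phi b c k l\<close> form a two-sided sequence \<open>s\<close> with the tropical recurrence
  \<open>s\<^sub>k\<^sub>+\<^sub>1 + s\<^sub>k\<^sub>-\<^sub>1 = t max(0, s\<^sub>k)\<close>, where \<open>t = sqrt (bc) = r + 1/r\<close> with \<open>r \<ge> 1\<close>, and the
  dominance region of \<open>l\<close> consists of the points whose sequence lies termwise below that of \<open>l\<close>.
  If some \<open>s\<^sub>k \<le> 0\<close>, the recurrence forces equality at the neighbours \<open>k \<plusminus> 1\<close>, then at \<open>k\<close>, then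
  everywhere; if all \<open>s\<^sub>k > 0\<close>, the recurrence is linear and the two-sided growth puts \<open>l\<close> in the
  imaginary cone. Inside the cone, the differences \<open>d\<close> satisfy
  \<open>d\<^sub>k\<^sub>+\<^sub>1 + d\<^sub>k\<^sub>-\<^sub>1 = t min(d\<^sub>k, s\<^sub>k)\<close>. The eight inequalities of the polygon, read at position \<open>k\<close>,
  imply \<open>d\<^sub>k, d\<^sub>k\<^sub>+\<^sub>1 \<ge> 0\<close> and are invariant under shifting \<open>k\<close>; conversely they follow from \<open>d \<ge> 0\<close>,
  because \<open>d\<^sub>k\<^sub>+\<^sub>1 - d\<^sub>k/r\<close> can never become negative without driving \<open>d\<close> below zero.\<close>

section \<open>One-sided recurrences: growth, cone and polygon inequalities\<close>

text \<open>The defect \<open>d (n+1) - d n / r\<close> is at most \<open>r\<close> times the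
  previous one, so once negative it never rises above its initial value. As
  \<open>d n / r \<le> d n\<close>, the sequence then falls at least linearly and becomes negative.
  Linear decay suffices, which covers \<open>r = 1\<close>.\<close>

lemma nonneg_seq_imp_growth:
  fixes d :: "nat \<Rightarrow> real"
  assumes r: "1 \<le> r" and nn: "\<And>n. 0 \<le> d n"
    and step: "\<And>n. d (n+2) - d (n+1) / r \<le> r * (d (n+1) - d n / r)"
  shows "d 0 / r \<le> d 1"
proof (rule ccontr)
  assume "\<not> ?thesis"
  define g where "g = d 1 - d 0 / r"
  with \<open>\<not> ?thesis\<close> have g: "g < 0" by simp
  have le: "d (n+1) - d n / r \<le> g" for n
  proof (induction n)
    case 0
    then show ?case by (simp add: g_def)
  next
    case (Suc n)
    let ?h = "d (n+1) - d n / r"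
    have "r * ?h \<le> 1 * ?h"
      using r Suc g by (intro mult_right_mono_neg) auto
    with step[of n] Suc show ?case by simp
  qed
  have "d n \<le> d 0 + real n * g" for n
  proof (induction n)
    case (Suc n)
    have "d n / r \<le> d n"
      using r nn[of n] by (simp add: divide_le_eq mult_le_cancel_left1)
    with le[of n] Suc show ?case by (simp add: algebra_simps)
  qed simp
  moreover obtain n where "d 0 < real n * (- g)"
    using reals_Archimedean3[of "- g"] g by auto
  ultimately show False using nn[of n] by (smt (verit) mult_minus_right)
qed

text \<open>The cone between the eigenlines \<open>y = r * x\<close> and \<open>y = x / r\<close> of
  the linear step from \<open>(x, y)\<close> to \<open>(y, (r + 1 / r) * y - x)\<close>. For
  \<open>r = 1\<close> it degenerates to a ray.\<close>

definition cone_pair :: "real \<Rightarrow> real \<Rightarrow> real \<Rightarrow> bool" where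
  "cone_pair r x y \<longleftrightarrow> 0 \<le> x \<and> 0 \<le> y \<and> x / r \<le> y \<and> y / r \<le> x"

lemma cone_pair_commute: "cone_pair r x y \<longleftrightarrow> cone_pair r y x"
  by (auto simp: cone_pair_def)

text \<open>The step only rescales the distances to the eigenlines: with \<open>z\<close> the new
  term, \<open>z - y / r = r * (y - x / r)\<close> and
  \<open>y - z / r = (x - y / r) / r\<close>.\<close>

lemma cone_pair_step:
  assumes r: "1 \<le> r" and "cone_pair r x y"
  shows "cone_pair r y ((r + 1 / r) * y - x)"
proof -
  have "y / r \<le> (r + 1 / r) * y - x"
    using assms by (simp add: cone_pair_def field_simps)
  moreover have "((r + 1 / r) * y - x) / r \<le> y"
  proof -
    have "((r + 1 / r) * y - x) / r = y - (x - y / r) / r"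
      using r by (simp add: field_simps)
    moreover have "0 \<le> (x - y / r) / r"
      using assms by (simp add: cone_pair_def)
    ultimately show ?thesis by linarith
  qed
  moreover have "0 \<le> y / r" using assms by (simp add: cone_pair_def)
  ultimately show ?thesis using assms(2) unfolding cone_pair_def by linarith
qed

text \<open>The eight inequalities of the polygon in terms of the differences
  \<open>x = d\<^sub>k\<close>, \<open>y = d\<^sub>k\<^sub>+\<^sub>1\<close> and the values \<open>a = S\<^sub>k\<close>, \<open>b = S\<^sub>k\<^sub>+\<^sub>1\<close> of the rescaled sequences.\<close>

definition polygon_pair :: "real \<Rightarrow> real \<Rightarrow> real \<Rightarrow> real \<Rightarrow> real \<Rightarrow> bool" where
  "polygon_pair r a b x y \<longleftrightarrow>
     0 \<le> x - y / r \<and> x - y / r \<le> (r + 1 / r) * (r * a - b) \<and>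
     0 \<le> x + y / r \<and> x + y / r \<le> (r + 1 / r) * b \<and>
     0 \<le> y - x / r \<and> y - x / r \<le> (r + 1 / r) * (r * b - a) \<and>
     0 \<le> y + x / r \<and> y + x / r \<le> (r + 1 / r) * a"

text \<open>Reversing a sequence swaps the two positions, so this symmetry reduces backward steps to
  forward ones.\<close>

lemma polygon_pair_commute: "polygon_pair r a b x y \<longleftrightarrow> polygon_pair r b a y x"
  unfolding polygon_pair_def by (smt (verit))

lemma polygon_pair_nonneg:
  assumes "polygon_pair r a b x y"
  shows "0 \<le> x" "0 \<le> y"
  using assms unfolding polygon_pair_def by linarith+

text \<open>Where the new term \<open>z\<close> must be bounded above, \<open>min y b\<close> is
  replaced by either argument. The facts \<open>A\<close> and \<open>D\<close> need \<open>z\<close>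
  bounded below and split on which argument is the minimum.\<close>

lemma polygon_pair_step:
  assumes r: "1 \<le> r" and P: "polygon_pair r a b x y"
  shows "polygon_pair r b ((r + 1 / r) * b - a) y ((r + 1 / r) * min y b - x)"
proof -
  define i where "i = 1 / r"
  have ri: "r * i = 1" "i * r = 1" and i: "0 < i" and div: "\<And>z. z / r = i * z"
    using r by (auto simp: i_def)
  have ri': "r * (i * z) = z" "i * (r * z) = z" for z
    using ri by (simp_all flip: mult.assoc)
  define z where "z = (r + i) * min y b - x"
  have z1: "z \<le> (r + i) * y - x" and z2: "z \<le> (r + i) * b - x"
    using r i by (auto simp: z_def intro!: mult_left_mono)
  have x: "0 \<le> x" and y: "0 \<le> y"
    using polygon_pair_nonneg[OF P] by auto
  have P': "0 \<le> x - i * y" "x - i * y \<le> (r + i) * (r * a - b)" "x + i * y \<le> (r + i) * b"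
    "0 \<le> y - i * x" "y - i * x \<le> (r + i) * (r * b - a)" "y + i * x \<le> (r + i) * a"
    using P by (auto simp: polygon_pair_def div simp flip: i_def)
  have A: "0 \<le> z - i * y"
  proof (cases "y \<le> b")
    case True
    have "z - i * y = r * (y - i * x)"
      using True by (simp add: z_def algebra_simps ri')
    then show ?thesis using P' r by simp
  next
    case False
    then show ?thesis using P' by (simp add: z_def)
  qed
  have C: "z - i * y \<le> (r + i) * (r * ((r + i) * b - a) - b)"
  proof -
    have "z - i * y \<le> r * (y - i * x)"
      using z1 by (simp add: algebra_simps ri')
    also have "\<dots> \<le> r * ((r + i) * (r * b - a))"
      using P' r by (intro mult_left_mono) auto
    also have "\<dots> = (r + i) * (r * ((r + i) * b - a) - b)"
      by (simp add: algebra_simps ri ri')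
    finally show ?thesis .
  qed
  have B: "0 \<le> y - i * z"
  proof -
    have "i * z \<le> i * ((r + i) * y - x)"
      using z1 i by (intro mult_left_mono) auto
    also have "\<dots> = y - i * (x - i * y)"
      by (simp add: algebra_simps ri')
    also have "\<dots> \<le> y"
      using P' i by simp
    finally show ?thesis by simp
  qed
  have D: "y - i * z \<le> (r + i) * (r * b - ((r + i) * b - a))"
  proof (cases "y \<le> b")
    case True
    have "y - i * z = i * (x - i * y)"
      using True by (simp add: z_def algebra_simps ri')
    also have "\<dots> \<le> i * ((r + i) * (r * a - b))"
      using P' i by (intro mult_left_mono) auto
    also have "\<dots> = (r + i) * (r * b - ((r + i) * b - a))"
      by (simp add: algebra_simps ri ri')
    finally show ?thesis .
  next
    case False
    then have "y - i * z = y + i * x - (r + i) * (i * b)"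
      by (simp add: z_def algebra_simps ri')
    also have "\<dots> \<le> (r + i) * a - (r + i) * (i * b)"
      using P' by simp
    finally show ?thesis by (simp add: algebra_simps)
  qed
  have E: "y + i * z \<le> (r + i) * ((r + i) * b - a)"
  proof -
    have "i * z \<le> i * ((r + i) * b - x)"
      using z2 i by (intro mult_left_mono) auto
    moreover have "(r + i) * ((r + i) * b - a) = (r + i) * (r * b - a) + i * ((r + i) * b)"
      by (simp add: algebra_simps)
    ultimately show ?thesis using P' by (simp add: right_diff_distrib)
  qed
  have F: "z + i * y \<le> (r + i) * b" using z2 P' by simp
  have z: "0 \<le> z" using A y i by (smt (verit) mult_nonneg_nonneg)
  show ?thesis
    unfolding polygon_pair_def div z_def[symmetric] 
    using A B C D E F x y z i
    by (simp add: i_def[symmetric] z_def[symmetric])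
qed

text \<open>These bounds come from looking forward only; the reversed sequence will supply the other
  half of \<open>polygon_pair\<close>. For the first, replacing the minimum by
  \<open>d (n+1)\<close> makes \<open>d\<close> a subsolution of the linear recurrence, to which the
  growth estimate applies. The second replaces it by \<open>S (n+1)\<close> and uses the first one
  index later.\<close>

lemma nonneg_seq_imp_forward_bounds:
  fixes d S :: "nat \<Rightarrow> real"
  assumes r: "1 \<le> r"
    and cone: "\<And>n. cone_pair r (S n) (S (n+1))"
    and S: "\<And>n. S (n+2) = (r + 1 / r) * S (n+1) - S n"
    and d: "\<And>n. d (n+2) = (r + 1 / r) * min (d (n+1)) (S (n+1)) - d n"
    and nn: "\<And>n. 0 \<le> d n"
  shows "d 0 / r \<le> d 1" "d 0 + d 1 / r \<le> (r + 1 / r) * S 1"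
    "d 1 - d 0 / r \<le> (r + 1 / r) * (r * S 1 - S 0)"
proof -
  have step: "(r + 1 / r) * y - x - y / r = r * (y - x / r)" for x y
    using r by (simp add: field_simps)
  have dle: "d (n+2) \<le> (r + 1 / r) * d (n+1) - d n" for n
    unfolding d using r by (simp add: mult_left_mono)
  have A: "d n / r \<le> d (n+1)" for n
  proof -
    have "d (m+2) - d (m+1) / r \<le> r * (d (m+1) - d m / r)" for m
      using dle[of m] step[of "d (m+1)" "d m"] by linarith
    from nonneg_seq_imp_growth[of r "\<lambda>m. d (m + n)", OF r] nn this[of "_ + n"]
    show ?thesis by (simp add: add_ac)
  qed
  have E: "d n + d (n+1) / r \<le> (r + 1 / r) * S (n+1)" for n
  proof -
    have "d (n+2) \<le> (r + 1 / r) * S (n+1) - d n"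
      unfolding d using r by (simp add: mult_left_mono)
    with A[of "n+1"] show ?thesis by simp
  qed
  show "d 0 / r \<le> d 1" "d 0 + d 1 / r \<le> (r + 1 / r) * S 1"
    using A[of 0] E[of 0] by simp_all
  txt \<open>A violation of the last bound propagates forward and excludes \<open>d n > S n\<close>. Then \<open>S - d\<close> is
    a nonnegative solution of the linear recurrence, whose growth contradicts the violation.\<close>
  let ?C = "\<lambda>n. d (n+1) - d n / r \<le> (r + 1 / r) * (r * S (n+1) - S n)"
  have C: "d (n+1) \<le> S (n+1) \<and> \<not> ?C (n+1)" if "\<not> ?C n" for n
  proof
    show unsat: "d (n+1) \<le> S (n+1)"
    proof (rule ccontr)
      assume "\<not> ?thesis"
      \<comment> \<open>Saturation gives \<open>d (n+2)\<close> exactly, and the bound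
        \<open>E\<close> one index later then rearranges to \<open>?C n\<close>.\<close>
      then have "d (n+2) = (r + 1 / r) * S (n+1) - d n" 
        using d[of n] by (simp add: min_def)
      then have "((r + 1 / r) * S (n+1) - d n) / r + d (n+1)
          \<le> (r + 1 / r) * ((r + 1 / r) * S (n+1) - S n)"
        using E[of "n+1"] S[of n] by (simp add: add_ac)
      then have "?C n" by (simp add: algebra_simps diff_divide_distrib add_divide_distrib)
      with that show False ..
    qed
    show "\<not> ?C (n+1)"
    proof
      assume C': "?C (n+1)"
      have "r * (d (n+1) - d n / r) = d (n+2) - d (n+1) / r"
        using unsat d[of n] step by simp
      also have "\<dots> \<le> (r + 1 / r) * (r * S (n+2) - S (n+1))"
        using C' by (simp add: add_ac)
      also have "r * S (n+2) - S (n+1) = r * (r * S (n+1) - S n)"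
        using r S[of n] by (simp add: field_simps)
      finally have "r * (d (n+1) - d n / r) \<le> r * ((r + 1 / r) * (r * S (n+1) - S n))"
        by (simp add: mult_ac)
      with that r show False by (simp only: mult_le_cancel_left) auto
    qed
  qed
  show "d 1 - d 0 / r \<le> (r + 1 / r) * (r * S 1 - S 0)"
  proof (rule ccontr)
    assume "\<not> ?thesis"
    then have nC: "\<not> ?C n" for n
      by (induction n) (use C in auto)
    then have le: "d (n+1) \<le> S (n+1)" for n using C by blast
    \<comment> \<open>The sequence starts at index 1 because \<open>le\<close> does.\<close>
    define x where "x n = S (n+1) - d (n+1)" for n
    have "x (n+2) = (r + 1 / r) * x (n+1) - x n" for n
      using S[of "n+1"] d[of "n+1"] le[of "n+1"] by (simp add: x_def algebra_simps)
    then have "x 0 / r \<le> x 1"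
      using le by (intro nonneg_seq_imp_growth[OF r]) (auto simp: x_def step)
    then have "d 2 - d 1 / r \<le> S 2 - S 1 / r"
      by (simp add: x_def diff_divide_distrib eval_nat_numeral)
    \<comment> \<open>The factor \<open>(r + 1 / r) * r = r * r + 1\<close> is at least 1, and the
      cone condition makes \<open>S 2 - S 1 / r\<close> nonnegative.\<close>
    also have "\<dots> \<le> (r + 1 / r) * r * (S 2 - S 1 / r)"
    proof -
      have "1 * (S 2 - S 1 / r) \<le> (r * r + 1) * (S 2 - S 1 / r)"
        using cone[of 1] by (intro mult_right_mono) (auto simp: cone_pair_def eval_nat_numeral)
      with r show ?thesis by (simp add: algebra_simps)
    qed
    also have "\<dots> = (r + 1 / r) * (r * S 2 - S 1)"
      using r by (simp add: right_diff_distrib mult.assoc)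
    finally show False using nC[of 1] by (simp add: eval_nat_numeral)
  qed
qed

section \<open>Two-sided sequences\<close>

lemma int_bidirectional_induct:
  assumes "P (0::int)" "\<And>k. P k \<Longrightarrow> P (k + 1)" "\<And>k. P k \<Longrightarrow> P (k - 1)"
  shows "P k"
  by (induction k rule: int_induct[where k = 0]) (use assms in auto)

text \<open>On the cone the terms are nonnegative, so \<open>max\<close> disappears and the linear
  step applies. The recurrence is symmetric in its two neighbours, so the same step also runs
  backwards.\<close>

lemma cone_pair_int_seq:
  fixes S :: "int \<Rightarrow> real"
  assumes r: "1 \<le> r" and S: "\<And>k. S (k+1) = (r + 1 / r) * max 0 (S k) - S (k-1)"
    and "cone_pair r (S 0) (S 1)"
  shows "cone_pair r (S k) (S (k+1))"
proof (induction k rule: int_bidirectional_induct)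
  case (2 k)
  then have "max 0 (S (k+1)) = S (k+1)" by (simp add: cone_pair_def)
  with cone_pair_step[OF r 2] S[of "k+1"] show ?case by (simp add: add_ac)
next
  case (3 k)
  then have "max 0 (S k) = S k" by (simp add: cone_pair_def)
  with cone_pair_step[OF r, of "S (k+1)" "S k"] 3 S[of k] show ?case
    by (simp add: cone_pair_commute)
qed (use assms in simp)

text \<open>Without negative terms the recurrence is linear. The growth estimate gives one cone
  inequality forwards and the other for the reflection of \<open>k\<close> to \<open>1 - k\<close>,
  which swaps positions 0 and 1.\<close>

lemma nonneg_int_seq_imp_cone_pair:
  fixes S :: "int \<Rightarrow> real"
  assumes r: "1 \<le> r" and S: "\<And>k. S (k+1) = (r + 1 / r) * max 0 (S k) - S (k-1)"
    and nn: "\<And>k. 0 \<le> S k"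
  shows "cone_pair r (S 0) (S 1)"
proof -
  have S': "S (k+1) = (r + 1 / r) * S k - S (k-1)" for k
    using S[of k] nn[of k] by simp
  have step: "(r + 1 / r) * y - x - y / r = r * (y - x / r)" for x y
    using r by (simp add: field_simps)
  have "S 0 / r \<le> S 1"
    using nonneg_seq_imp_growth[OF r, of "\<lambda>n. S (int n)"] nn S'[of "int _ + 1"]
    by (simp add: step add_ac)
  moreover have "S 1 / r \<le> S 0"
  proof -
    have "S (1 - int (n+2)) = (r + 1 / r) * S (1 - int (n+1)) - S (1 - int n)" for n
    proof -
      have eq: "1 - int (n+2) = - int n - 1" "1 - int (n+1) = - int n" "1 - int n = - int n + 1"
        by simp_all
      show ?thesis unfolding eq S'[of "- int n"] by simp
    qed
    with nonneg_seq_imp_growth[OF r, of "\<lambda>n. S (1 - int n)"] nn show ?thesis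
      by (simp add: step)
  qed
  ultimately show ?thesis using nn by (simp add: cone_pair_def)
qed

lemma nonneg_int_seq_iff_polygon_pair:
  fixes S d :: "int \<Rightarrow> real"
  assumes r: "1 \<le> r"
    and S: "\<And>k. S (k+1) = (r + 1 / r) * S k - S (k-1)"
    and d: "\<And>k. d (k+1) = (r + 1 / r) * min (d k) (S k) - d (k-1)"
    and cone: "\<And>k. cone_pair r (S k) (S (k+1))"
  shows "(\<forall>k. 0 \<le> d k) \<longleftrightarrow> polygon_pair r (S 0) (S 1) (d 0) (d 1)"
proof
  assume nn: "\<forall>k. 0 \<le> d k"
  have fwd: "d 0 / r \<le> d 1" "d 0 + d 1 / r \<le> (r + 1 / r) * S 1"
    "d 1 - d 0 / r \<le> (r + 1 / r) * (r * S 1 - S 0)"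
    using nonneg_seq_imp_forward_bounds[OF r, of "\<lambda>n. S (int n)" "\<lambda>n. d (int n)"]
      cone[of "int _"] nn S[of "int _ + 1"] d[of "int _ + 1"] by (simp_all add: add_ac)
  have "cone_pair r (S (1 - int n)) (S (1 - int (n+1)))" for n
    using cone[of "- int n"] by (simp add: cone_pair_commute algebra_simps)
  moreover have "S (1 - int (n+2)) = (r + 1 / r) * S (1 - int (n+1)) - S (1 - int n)"
    "d (1 - int (n+2)) = (r + 1 / r) * min (d (1 - int (n+1))) (S (1 - int (n+1))) - d (1 - int n)"
    for n
  proof -
    have eq: "1 - int (n+2) = - int n - 1" "1 - int (n+1) = - int n" "1 - int n = - int n + 1"
      by simp_all
    show "S (1 - int (n+2)) = (r + 1 / r) * S (1 - int (n+1)) - S (1 - int n)"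
      "d (1 - int (n+2)) = (r + 1 / r) * min (d (1 - int (n+1))) (S (1 - int (n+1))) - d (1 - int n)"
      unfolding eq S[of "- int n"] d[of "- int n"] by simp_all
  qed
  ultimately have "d 1 / r \<le> d 0" "d 1 + d 0 / r \<le> (r + 1 / r) * S 0"
    "d 0 - d 1 / r \<le> (r + 1 / r) * (r * S 0 - S 1)"
    using nonneg_seq_imp_forward_bounds[OF r, of "\<lambda>n. S (1 - int n)" "\<lambda>n. d (1 - int n)"] nn
    by simp_all
  moreover have "0 \<le> d 0 / r" "0 \<le> d 1 / r" "0 \<le> d 0" "0 \<le> d 1"
    using nn r by simp_all
  ultimately show "polygon_pair r (S 0) (S 1) (d 0) (d 1)"
    using fwd unfolding polygon_pair_def by linarith
next
  assume *: "polygon_pair r (S 0) (S 1) (d 0) (d 1)"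
  have "polygon_pair r (S k) (S (k+1)) (d k) (d (k+1))" for k
  proof (induction k rule: int_bidirectional_induct)
    case (2 k)
    from polygon_pair_step[OF r 2] S[of "k+1"] d[of "k+1"] show ?case by (simp add: add_ac)
  next
    case (3 k)
    then have "polygon_pair r (S (k+1)) (S k) (d (k+1)) (d k)" by (simp add: polygon_pair_commute)
    from polygon_pair_step[OF r this] S[of k] d[of k] show ?case
      by (simp add: polygon_pair_commute)
  qed (use * in simp)
  then show "\<forall>k. 0 \<le> d k" using polygon_pair_nonneg by blast
qed

lemma int_seq_eqI:
  fixes s u :: "int \<Rightarrow> real"
  assumes s: "\<And>k. s (k+1) = t * max 0 (s k) - s (k-1)"
    and u: "\<And>k. u (k+1) = t * max 0 (u k) - u (k-1)"
    and le: "\<And>k. u k \<le> s k" and k: "s k \<le> 0"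
  shows "u = s"
proof
  have neighbours: "u (k+1) = s (k+1) \<and> u (k-1) = s (k-1)"
    using s[of k] u[of k] le[of k] le[of "k+1"] le[of "k-1"] k by simp
  then have "u (k+2) + u k = s (k+2) + s k"
    using s[of "k+1"] u[of "k+1"] by (simp add: add_ac)
  then have k0: "u k = s k" using le[of k] le[of "k+2"] by linarith
  have "u (k+i) = s (k+i) \<and> u (k+i+1) = s (k+i+1)" for i
  proof (induction i rule: int_bidirectional_induct)
    case (2 i)
    then show ?case using s[of "k+i+1"] u[of "k+i+1"] by (simp add: add_ac)
  next
    case (3 i)
    then show ?case using s[of "k+i"] u[of "k+i"] by (simp add: algebra_simps)
  qed (use neighbours k0 in simp)
  from this[of "_ - k"] show "u j = s j" for j by simp
qed

section \<open>The maps \<open>phi\<close> as powers of one bijection\<close>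

lemma int_funpow_add_1:
  assumes "bij f"
  shows "int_funpow f (j + 1) x = f (int_funpow f j x)"
proof (cases "j \<ge> 0")
  case True
  then show ?thesis by (simp add: int_funpow_def nat_add_distrib)
next
  case False
  then obtain n where j: "j = - int (Suc n)" by (metis negD not_le)
  have "f (inv f z) = z" for z
    using assms by (simp add: bij_is_surj surj_f_inv_f)
  \<comment> \<open>The case \<open>n = 0\<close> is the passage from -1 to 0, where
    \<open>int_funpow\<close> switches from powers of \<open>inv f\<close> to powers of
    \<open>f\<close>.\<close>
  with j show ?thesis
    by (cases n) (simp_all add: int_funpow_def nat_add_distrib)
qed

definition psi :: "nat \<Rightarrow> nat \<Rightarrow> real \<times> real \<Rightarrow> real \<times> real" where
  "psi b c = inv (phi_neg b) \<circ> phi_pos c"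

text \<open>One application performs two steps of the tropical recurrence: \<open>y\<close> replaces
  the negated second coordinate, then the first coordinate is updated from \<open>y\<close>. The
  inverse is evaluated by exhibiting a preimage under \<open>phi_neg\<close>.\<close>

lemma psi_eq:
  "psi b c l = (let y = real c * max 0 (fst l) + snd l in (real b * max 0 y - fst l, - y))"
proof -
  define y where "y = real c * max 0 (fst l) + snd l"
  have "phi_pos c l = (- fst l, y)"
    by (cases l) (auto simp: phi_pos_def y_def)
  moreover have "phi_neg b (real b * max 0 y - fst l, - y) = (- fst l, y)"
    by (auto simp: phi_neg_def)
  ultimately have "inv (phi_neg b) (phi_pos c l) = (real b * max 0 y - fst l, - y)"
    by (metis bij_is_inj bij_phi_neg inv_f_f)
  then show ?thesis by (simp add: psi_def y_def)
qed

lemma bij_psi: "bij (psi b c)"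
  unfolding psi_def by (intro bij_comp bij_phi_pos bij_imp_bij_inv bij_phi_neg)

lemma phi_even: "phi b c (2 * j) = int_funpow (psi b c) j"
  by (auto simp: phi_def psi_def int_funpow_def)

text \<open>The separately defined index -1 fits the uniform formula because
  \<open>phi_pos c\<close> cancels in \<open>phi_pos c \<circ> inv (psi b c)\<close>, leaving
  \<open>phi_neg b\<close>.\<close>

lemma phi_odd: "phi b c (2 * j + 1) = phi_pos c \<circ> int_funpow (psi b c) j"
proof (cases "j = - 1")
  case True
  have "inv (psi b c) = inv (phi_pos c) \<circ> phi_neg b"
    using bij_phi_neg bij_phi_pos
    by (simp add: psi_def o_inv_distrib bij_imp_bij_inv inv_inv_eq)
  then have "phi_pos c \<circ> inv (psi b c) = phi_neg b"
    by (simp add: o_assoc surj_iff[THEN iffD1, OF bij_is_surj[OF bij_phi_pos]])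
  with True show ?thesis by (simp add: phi_def int_funpow_def)
next
  case False
  then show ?thesis by (auto simp: phi_def psi_def int_funpow_def)
qed

lemma mem_quadrant:
  "x \<in> quadrant k l \<longleftrightarrow>
     (if even k then fst x \<le> fst l \<and> snd l \<le> snd x else fst l \<le> fst x \<and> snd x \<le> snd l)"
proof -
  have "x = (fst l - (fst l - fst x), snd l + (snd x - snd l))"
    "x = (fst l + (fst x - fst l), snd l - (snd l - snd x))" by simp_all
  then show ?thesis
    unfolding quadrant_def by (smt (verit) mem_Collect_eq fst_conv snd_conv)
qed

lemma snd_psi: "snd (psi b c l) = - snd (phi_pos c l)"
  by (cases l) (auto simp: psi_eq phi_pos_def Let_def)

lemma fst_phi_pos: "fst (phi_pos c l) = - fst l"
  by (cases l) (auto simp: phi_pos_def)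

text \<open>The odd index \<open>2 * j + 1\<close> repeats known conditions: up to sign, its first
  coordinate is that at \<open>2 * j\<close> and its second that at \<open>2 * j + 2\<close>, and
  the odd quadrant reverses the inequalities accordingly.\<close>

lemma mem_dominance_region:
  "m \<in> dominance_region b c l \<longleftrightarrow>
     (\<forall>j. fst (int_funpow (psi b c) j m) \<le> fst (int_funpow (psi b c) j l) \<and>
          snd (int_funpow (psi b c) j l) \<le> snd (int_funpow (psi b c) j m))"
    (is "_ \<longleftrightarrow> (\<forall>j. ?Q j)")
proof -
  have "m \<in> dominance_region b c l \<longleftrightarrow> (\<forall>k. phi b c k m \<in> quadrant k (phi b c k l))"
    by (simp add: dominance_region_def)
  also have "\<dots> \<longleftrightarrow> (\<forall>j. phi b c (2*j) m \<in> quadrant (2*j) (phi b c (2*j) l)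
      \<and> phi b c (2*j+1) m \<in> quadrant (2*j+1) (phi b c (2*j+1) l))"
    by (metis evenE oddE)
  also have "\<dots> \<longleftrightarrow> (\<forall>j. ?Q j)"
  proof (intro iffI allI)
    fix j assume *: "\<forall>j. ?Q j"
    have "snd (psi b c (int_funpow (psi b c) j l)) \<le> snd (psi b c (int_funpow (psi b c) j m))"
      using *[rule_format, of "j+1"] by (simp add: int_funpow_add_1 bij_psi)
    with * show "phi b c (2*j) m \<in> quadrant (2*j) (phi b c (2*j) l)
      \<and> phi b c (2*j+1) m \<in> quadrant (2*j+1) (phi b c (2*j+1) l)"
      by (simp add: phi_even phi_odd mem_quadrant snd_psi fst_phi_pos)
  qed (simp add: phi_even mem_quadrant)
  finally show ?thesis .
qed

text \<open>Index \<open>2 * j\<close> holds the negated second coordinate and \<open>2 * j + 1\<close> the first coordinate of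
  \<open>phi b c (2 * j) l\<close>; the odd maps \<open>phi\<close> contribute no further coordinates.\<close>

definition tropical_seq :: "nat \<Rightarrow> nat \<Rightarrow> real \<times> real \<Rightarrow> int \<Rightarrow> real" where
  "tropical_seq b c l k =
     (if even k then - snd (int_funpow (psi b c) (k div 2) l) / sqrt (real c)
      else fst (int_funpow (psi b c) (k div 2) l) / sqrt (real b))"

section \<open>Dominance regions through the symmetrised recurrence\<close>

text \<open>Dividing by square roots gives even and odd steps the same coefficient
  \<open>sqrt (real b) * sqrt (real c)\<close>; \<open>r\<close> is the larger eigenvalue of the
  resulting linear recurrence.\<close>

locale rank_two =
  fixes b c :: nat and r :: real
  assumes b: "0 < b" and c: "0 < c" and r: "1 \<le> r"
    and trace: "r + 1 / r = sqrt (real b) * sqrt (real c)"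
begin

lemma mem_dominance_region_iff_tropical_seq:
  "m \<in> dominance_region b c l \<longleftrightarrow> (\<forall>k. tropical_seq b c m k \<le> tropical_seq b c l k)"
proof -
  have "(\<forall>k. tropical_seq b c m k \<le> tropical_seq b c l k) \<longleftrightarrow>
    (\<forall>j. tropical_seq b c m (2*j) \<le> tropical_seq b c l (2*j) \<and>
         tropical_seq b c m (2*j+1) \<le> tropical_seq b c l (2*j+1))"
    by (metis evenE oddE)
  also have "\<dots> \<longleftrightarrow> m \<in> dominance_region b c l"
    using b c by (auto simp: tropical_seq_def mem_dominance_region divide_le_cancel)
  finally show ?thesis ..
qed

lemma tropical_seq_rec:
  "tropical_seq b c l (k+1) = (r + 1 / r) * max 0 (tropical_seq b c l k) - tropical_seq b c l (k-1)"
proof -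
  have pos: "0 < sqrt (real b)" "0 < sqrt (real c)" using b c by simp_all
  have scale: "sqrt b * sqrt c * (z / sqrt c) = b * z / sqrt b"
    "sqrt b * sqrt c * (z / sqrt b) = c * z / sqrt c" for z :: real
    using b c by (simp_all add: field_simps)
  have mx: "max 0 (x / s) = max 0 x / s" if "0 < s" for x s :: real
    using that by (auto simp: max_def field_simps)
  show ?thesis
  proof (cases "even k")
    case True
    then obtain j where k: "k = 2 * j" by blast
    \<comment> \<open>For \<open>k = 2 * j\<close> the term at \<open>k - 1\<close> already belongs
      to the iterate \<open>j - 1\<close>, so all three terms are expressed through that
      iterate.\<close>
    define w where "w = int_funpow (psi b c) (j - 1) l"
    define y where "y = real c * max 0 (fst w) + snd w"
    have w': "int_funpow (psi b c) j l = psi b c w"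
      using int_funpow_add_1[OF bij_psi, of b c "j-1" l] by (simp add: w_def)
    have "(k - 1) div 2 = j - 1" "(k + 1) div 2 = j" using k by auto
    then have "tropical_seq b c l (k+1) = (b * max 0 y - fst w) / sqrt b"
      "tropical_seq b c l k = y / sqrt c"
      "tropical_seq b c l (k-1) = fst w / sqrt b"
      using True k by (simp_all add: tropical_seq_def w' psi_eq y_def flip: w_def)
    with pos show ?thesis
      by (simp only: trace mx scale diff_divide_distrib)
  next
    case False
    then obtain j where k: "k = 2 * j + 1" by (elim oddE)
    define w where "w = int_funpow (psi b c) j l"
    have w': "int_funpow (psi b c) (j + 1) l = psi b c w"
      by (simp add: int_funpow_add_1 bij_psi w_def)
    have "(k - 1) div 2 = j" "k div 2 = j" "(k + 1) div 2 = j + 1" using k by auto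
    then have "tropical_seq b c l (k+1) = (c * max 0 (fst w) + snd w) / sqrt c"
      "tropical_seq b c l k = fst w / sqrt b"
      "tropical_seq b c l (k-1) = - snd w / sqrt c"
      using False by (simp_all add: tropical_seq_def w' psi_eq Let_def flip: w_def)
    with pos show ?thesis
      by (simp add: trace mx scale add_divide_distrib del: times_divide_eq_right)
  qed
qed

lemma tropical_seq_0: "tropical_seq b c l 0 = - snd l / sqrt (real c)"
  and tropical_seq_1: "tropical_seq b c l 1 = fst l / sqrt (real b)"
  by (simp_all add: tropical_seq_def int_funpow_def)

text \<open>Some term is nonpositive, since otherwise the cone condition would follow. There every
  dominated sequence is rigid, and terms 0 and 1 recover the point.\<close>

lemma dominance_region_outside_cone:
  assumes "\<not> cone_pair r (tropical_seq b c l 0) (tropical_seq b c l 1)"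
  shows "dominance_region b c l = {l}"
proof -
  obtain k where k: "tropical_seq b c l k \<le> 0"
    using nonneg_int_seq_imp_cone_pair[of r "tropical_seq b c l", OF r tropical_seq_rec] assms by (meson linear)
  have "m = l" if "m \<in> dominance_region b c l" for m
  proof -
    have "tropical_seq b c m = tropical_seq b c l"
      using int_seq_eqI[of "tropical_seq b c l" "r + 1 / r" "tropical_seq b c m" k,
          OF tropical_seq_rec tropical_seq_rec _ k] that
      by (simp add: mem_dominance_region_iff_tropical_seq)
    then have "tropical_seq b c m 0 = tropical_seq b c l 0"
      "tropical_seq b c m 1 = tropical_seq b c l 1" by simp_all
    then show ?thesis
      using b c by (simp add: tropical_seq_0 tropical_seq_1 prod_eq_iff)
  qed
  then show ?thesis by (auto simp: mem_dominance_region_iff_tropical_seq)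
qed

lemma dominance_region_inside_cone:
  assumes cone: "cone_pair r (tropical_seq b c l 0) (tropical_seq b c l 1)"
  shows "m \<in> dominance_region b c l \<longleftrightarrow>
    polygon_pair r (tropical_seq b c l 0) (tropical_seq b c l 1)
      (tropical_seq b c l 0 - tropical_seq b c m 0) (tropical_seq b c l 1 - tropical_seq b c m 1)"
proof -
  let ?S = "tropical_seq b c l" and ?M = "tropical_seq b c m"
  have cone_all: "cone_pair r (?S k) (?S (k+1))" for k
    by (rule cone_pair_int_seq[OF r tropical_seq_rec cone])
  have mS: "max 0 (?S k) = ?S k" for k using cone_all[of k] by (simp add: cone_pair_def)
  have S: "?S (k+1) = (r + 1 / r) * ?S k - ?S (k-1)" for k
    using tropical_seq_rec[of l k] mS by simp
  have "?S (k+1) - ?M (k+1) =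
      (r + 1 / r) * min (?S k - ?M k) (?S k) - (?S (k-1) - ?M (k-1))" for k
  proof -
    \<comment> \<open>This identity turns the \<open>max\<close> in the recurrence of
      \<open>?M\<close> into saturation of the difference at \<open>?S\<close>.\<close>
    have min_eq: "min (?S k - ?M k) (?S k) = ?S k - max 0 (?M k)" by linarith
    show ?thesis unfolding min_eq S[of k] tropical_seq_rec[of m k] by (simp add: algebra_simps)
  qed
  from nonneg_int_seq_iff_polygon_pair[OF r S this cone_all]
  show ?thesis by (simp add: mem_dominance_region_iff_tropical_seq)
qed


section \<open>Return to the original coordinates\<close>

text \<open>From \<open>b * c = (r + 1 / r)\<^sup>2\<close> follows
  \<open>b * c - 4 = (r - 1 / r)\<^sup>2\<close>, and \<open>r \<ge> 1\<close> fixes the sign of the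
  root.\<close>

lemma disc_root_eq: "disc_root b c = sqrt (real b) * sqrt (real c) * (r - 1 / r)"
proof -
  have "real b * real c = (r + 1 / r)\<^sup>2"
    unfolding trace by (simp add: power_mult_distrib)
  moreover have "(r + 1 / r)\<^sup>2 - 4 = (r - 1 / r)\<^sup>2"
    using r by (simp add: power2_eq_square field_simps)
  moreover have "0 \<le> r - 1 / r"
    using r mult_mono[OF r r] by (simp add: field_simps)
  ultimately have "disc_root b c = (r + 1 / r) * (r - 1 / r)"
    using r by (simp add: disc_root_def real_sqrt_mult)
  then show ?thesis by (simp add: trace)
qed

text \<open>Up to the scaling of the axes, the irrational coefficients of the polygon are the
  eigenvalues \<open>1 / r\<close> and \<open>r\<close>.\<close>

lemma eigen_slopes:
  "(real b * real c - disc_root b c) / (2 * real b) = sqrt (real c) / sqrt (real b) / r"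
  "(real b * real c + disc_root b c) / (2 * real b) = sqrt (real c) / sqrt (real b) * r"
  "(real b * real c - disc_root b c) / (2 * real c) = sqrt (real b) / sqrt (real c) / r"
  "(real b * real c + disc_root b c) / (2 * real c) = sqrt (real b) / sqrt (real c) * r"
proof -
  define s u where "s = sqrt (real b)" and "u = sqrt (real c)"
  have su: "real b = s * s" "real c = u * u" "0 < s" "0 < u"
    using b c by (simp_all add: s_def u_def)
  have "disc_root b c = s * u * (r - 1 / r)" by (simp add: disc_root_eq s_def u_def)
  moreover have "real b * real c = s * u * (r + 1 / r)"
    unfolding trace s_def[symmetric] u_def[symmetric] unfolding su by simp
  ultimately have *: "real b * real c - disc_root b c = 2 * (s * u / r)"
    "real b * real c + disc_root b c = 2 * (s * u * r)"
    by (simp_all only: distrib_left right_diff_distrib times_divide_eq_right mult_1_right)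
  show "(real b * real c - disc_root b c) / (2 * real b) = sqrt (real c) / sqrt (real b) / r"
    "(real b * real c + disc_root b c) / (2 * real b) = sqrt (real c) / sqrt (real b) * r"
    "(real b * real c - disc_root b c) / (2 * real c) = sqrt (real b) / sqrt (real c) / r"
    "(real b * real c + disc_root b c) / (2 * real c) = sqrt (real b) / sqrt (real c) * r"
    unfolding * s_def[symmetric] u_def[symmetric] unfolding su using su(3,4) r
    by (simp_all add: field_simps)
qed

text \<open>After scaling, the generators are eigenvectors spanning the edges of the cone in
  \<open>cone_pair\<close>. Minimality of the hull gives one inclusion, explicit coefficients the
  other.\<close>

lemma mem_imaginary_cone_iff:
  "l \<in> imaginary_cone b c \<longleftrightarrow> cone_pair r (tropical_seq b c l 0) (tropical_seq b c l 1)"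
proof -
  define s u where "s = sqrt (real b)" and "u = sqrt (real c)"
  have su: "real b = s * s" "real c = u * u" "0 < s" "0 < u"
    using b c by (simp_all add: s_def u_def)
  have tr: "s * u = r + 1 / r" by (simp add: trace s_def u_def)
  have bc: "real b * real c = s * u * (r + 1 / r)"
    unfolding tr[symmetric] by (simp add: su)
  have disc: "disc_root b c = s * u * (r - 1 / r)"
    by (simp add: disc_root_eq s_def u_def)
  let ?v = "(2 * real b, - (real b * real c) + disc_root b c)"
  let ?w = "(2 * real b, - (real b * real c) - disc_root b c)"
  have v: "?v = (2 * s * s, - 2 * s * u / r)" and w: "?w = (2 * s * s, - 2 * s * u * r)"
    unfolding bc disc unfolding su(1) by (simp_all add: algebra_simps)
  have rr: "1 \<le> r * r" using mult_mono[OF r r] r by simp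
  define K where "K = {l. cone_pair r (tropical_seq b c l 0) (tropical_seq b c l 1)}"
  have K: "K = {l. 0 \<le> fst l \<and> snd l \<le> 0 \<and> - snd l / u / r \<le> fst l / s \<and> fst l / s / r \<le> - snd l / u}"
    using su by (auto simp: K_def cone_pair_def tropical_seq_0 tropical_seq_1 zero_le_divide_iff divide_le_0_iff
      simp flip: s_def u_def)
  have "convex_cone K"
    unfolding convex_cone_iff
  proof safe
    show "0 \<in> K" by (simp add: K)
    fix a a' :: real and x x' :: "real \<times> real"
    show "x + x' \<in> K" if "x \<in> K" "x' \<in> K"
      using that by (auto simp: K diff_divide_distrib add_divide_distrib)
    show "a *\<^sub>R x \<in> K" if "x \<in> K" "0 \<le> a"
    proof -
      have "a * (- snd x / u / r) \<le> a * (fst x / s)" "a * (fst x / s / r) \<le> a * (- snd x / u)"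
        using that by (intro mult_left_mono; simp add: K)+
      then show ?thesis using that by (simp add: K mult_nonneg_nonpos)
    qed
  qed
  moreover have "?v \<in> K" "?w \<in> K"
    unfolding v w using su(3,4) r rr by (auto simp: K field_simps)
  ultimately have "imaginary_cone b c \<subseteq> K"
    unfolding imaginary_cone_def by (intro hull_minimal) auto
  moreover have "l \<in> imaginary_cone b c" if "l \<in> K" for l
  proof -
    let ?C = "imaginary_cone b c"
    have C: "convex_cone ?C" and vC: "?v \<in> ?C" and wC: "?w \<in> ?C"
      by (auto simp: imaginary_cone_def convex_cone_convex_cone_hull intro: hull_inc)
    define x y where "x = fst l / s" and "y = - snd l / u"
    have xy: "0 \<le> x" "0 \<le> y" "y / r \<le> x" "x / r \<le> y" and l: "l = (s * x, - u * y)"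
      using that su(3,4) by (auto simp: K divide_le_0_iff x_def y_def prod_eq_iff)
    show ?thesis
    proof (cases "r = 1")
      \<comment> \<open>Both generators coincide here, and the coefficients of the general case
        would have denominator zero.\<close>
      case True
      with xy have "y = x" by simp
      then have "l = (x / (2 * s)) *\<^sub>R ?v"
        unfolding v l using su(3,4) True by simp
      then show ?thesis using convex_cone_scaleR[OF C _ vC] xy su by (metis divide_nonneg_pos mult_pos_pos zero_less_numeral)
    next
      case False
      with r have r1: "1 < r" by simp
      \<comment> \<open>Solution of the linear system \<open>2 * s * (p + q) = x\<close>,
        \<open>2 * s * (p / r + q * r) = y\<close>.\<close>
      define p q where "p = (r * x - y) / (2 * s * (r - 1 / r))" and "q = (y - x / r) / (2 * s * (r - 1 / r))"
      have den: "0 < r - 1 / r" using r1 by (simp add: field_simps less_1_mult)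
      then have "0 \<le> p" "0 \<le> q"
        using xy su r1 by (auto simp: p_def q_def field_simps intro!: divide_nonneg_nonneg)
      moreover have "l = p *\<^sub>R ?v + q *\<^sub>R ?w"
      proof -
        define e where "e = r - 1 / r"
        have "2 * s * (p + q) * e = x * e" "2 * s * (p / r + q * r) * e = y * e"
          using den su(3) r1 by (simp_all add: p_def q_def e_def[symmetric] field_simps)
            (simp_all add: e_def field_simps)
        then have "2 * s * (p + q) = x" "2 * s * (p / r + q * r) = y"
          using den by (simp_all add: e_def)
        then show ?thesis
          unfolding v w l by (auto simp: algebra_simps)
      qed
      ultimately show ?thesis
        using convex_cone_add[OF C convex_cone_scaleR[OF C _ vC] convex_cone_scaleR[OF C _ wC]] by simp
    qed
  qed
  ultimately show ?thesis unfolding K_def by blast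
qed

lemma polytope_dominance_region:
  assumes cone: "cone_pair r (tropical_seq b c l 0) (tropical_seq b c l 1)"
  shows "polytope (dominance_region b c l)"
proof -
  define s u where "s = sqrt (real b)" and "u = sqrt (real c)"
  have pos: "0 < s" "0 < u" using b c by (simp_all add: s_def u_def)
  define A B where "A = tropical_seq b c l 0" and "B = tropical_seq b c l 1"
  define t where "t = r + 1 / r"
  let ?D = "dominance_region b c l"
  have D: "m \<in> ?D \<longleftrightarrow> polygon_pair r A B (A + snd m / u) (B - fst m / s)" for m
    using dominance_region_inside_cone[OF cone, of m]
    by (simp add: A_def B_def tropical_seq_0 tropical_seq_1 s_def u_def)
  have "?D =
      {m. (- 1 / s / r, - 1 / u) \<bullet> m \<le> A - B / r} \<inter>
      {m. (1 / s / r, 1 / u) \<bullet> m \<le> t * (r * A - B) - A + B / r} \<inter>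
      {m. (1 / s / r, - 1 / u) \<bullet> m \<le> A + B / r} \<inter>
      {m. (- 1 / s / r, 1 / u) \<bullet> m \<le> t * B - A - B / r} \<inter>
      {m. (1 / s, 1 / u / r) \<bullet> m \<le> B - A / r} \<inter>
      {m. (- 1 / s, - 1 / u / r) \<bullet> m \<le> t * (r * B - A) - B + A / r} \<inter>
      {m. (1 / s, - 1 / u / r) \<bullet> m \<le> B + A / r} \<inter>
      {m. (- 1 / s, 1 / u / r) \<bullet> m \<le> t * A - B - A / r}"
    by (rule set_eqI) (auto simp: D polygon_pair_def inner_prod_def t_def[symmetric]
      diff_divide_distrib add_divide_distrib)
  then have "polyhedron ?D"
    by (simp only:) (intro polyhedron_Int polyhedron_halfspace_le)
  moreover have "bounded ?D"
  proof -
    \<comment> \<open>The box comes from \<open>x, y \<ge> 0\<close> together with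
      \<open>x + y / r \<le> t * B\<close> and \<open>y + x / r \<le> t * A\<close>.\<close>
    have "?D \<subseteq> {s * (B - t * A)..s * (B - 0)} \<times> {u * (0 - A)..u * (t * B - A)}"
    proof
      fix m assume "m \<in> ?D"
      define x y where "x = A + snd m / u" and "y = B - fst m / s"
      have P: "polygon_pair r A B x y" using \<open>m \<in> ?D\<close> by (simp add: D x_def y_def)
      have xy: "0 \<le> x" "0 \<le> y" using polygon_pair_nonneg[OF P] .
      then have "0 \<le> x / r" "0 \<le> y / r" using r by simp_all
      then have "x \<le> t * B" "y \<le> t * A"
        using P unfolding polygon_pair_def t_def[symmetric] by linarith+
      moreover have "fst m = s * (B - y)" "snd m = u * (x - A)"
        using pos by (simp_all add: x_def y_def)
      ultimately show "m \<in> {s * (B - t * A)..s * (B - 0)} \<times> {u * (0 - A)..u * (t * B - A)}"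
        using pos xy by (simp add: mem_Times_iff mult_left_mono del: diff_0 diff_0_right)
    qed
    then show ?thesis
      by (rule bounded_subset[OF bounded_Times[OF bounded_closed_interval bounded_closed_interval]])
  qed
  ultimately show ?thesis by (simp add: polytope_eq_bounded_polyhedron)
qed

text \<open>Each inequality on the right is the matching one of \<open>polygon_pair\<close>
  multiplied by \<open>sqrt (real b)\<close> or \<open>sqrt (real c)\<close>.\<close>

lemma polygon_pair_tropical_seq:
  "polygon_pair r (tropical_seq b c (x, y) 0) (tropical_seq b c (x, y) 1)
      (tropical_seq b c (x, y) 0 - tropical_seq b c (m0, m1) 0)
      (tropical_seq b c (x, y) 1 - tropical_seq b c (m0, m1) 1) \<longleftrightarrow>
   0 \<le> (real b * real c - disc_root b c) / (2 * real b) * (m0 - x) + (m1 - y) \<and>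
   (real b * real c - disc_root b c) / (2 * real b) * (m0 - x) + (m1 - y)
     \<le> - real c * x - (real b * real c + disc_root b c) / (2 * real b) * real b * y \<and>
   0 \<le> - ((real b * real c - disc_root b c) / (2 * real b)) * (m0 - x) + (m1 - y) \<and>
   - ((real b * real c - disc_root b c) / (2 * real b)) * (m0 - x) + (m1 - y) \<le> real c * x \<and>
   0 \<le> - (m0 - x) - (real b * real c - disc_root b c) / (2 * real c) * (m1 - y) \<and>
   - (m0 - x) - (real b * real c - disc_root b c) / (2 * real c) * (m1 - y)
     \<le> (real b * real c + disc_root b c) / (2 * real c) * real c * x + real b * y \<and>
   0 \<le> - (m0 - x) + (real b * real c - disc_root b c) / (2 * real c) * (m1 - y) \<and>
   - (m0 - x) + (real b * real c - disc_root b c) / (2 * real c) * (m1 - y) \<le> - real b * y"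
proof -
  define s u where "s = sqrt (real b)" and "u = sqrt (real c)"
  have su: "real b = s * s" "real c = u * u" and pos: "0 < s" "0 < u"
    using b c by (simp_all add: s_def u_def)
  define A B X Y where "A = - y / u" and "B = x / s" and "X = (x - m0) / s" and "Y = (m1 - y) / u"
  have eqs: "x = s * B" "y = - u * A" "m0 - x = - s * X" "m1 - y = u * Y"
    using pos by (simp_all add: A_def B_def X_def Y_def)
  have ts: "tropical_seq b c (x, y) 0 = A" "tropical_seq b c (x, y) 1 = B"
    "tropical_seq b c (x, y) 0 - tropical_seq b c (m0, m1) 0 = Y"
    "tropical_seq b c (x, y) 1 - tropical_seq b c (m0, m1) 1 = X"
    by (simp_all add: tropical_seq_0 tropical_seq_1 A_def B_def X_def Y_def diff_divide_distrib
        flip: s_def u_def)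
  have cancel: "u / s / r * (- s * X) + u * Y = u * (Y - X / r)"
    "- (u * u) * (s * B) - u / s * r * (s * s) * (- u * A) = u * (s * u * (r * A - B))"
    "- (u / s / r) * (- s * X) + u * Y = u * (Y + X / r)"
    "u * u * (s * B) = u * (s * u * B)"
    "- (- s * X) - s / u / r * (u * Y) = s * (X - Y / r)"
    "s / u * r * (u * u) * (s * B) + s * s * (- u * A) = s * (s * u * (r * B - A))"
    "- (- s * X) + s / u / r * (u * Y) = s * (X + Y / r)"
    "- (s * s) * (- u * A) = s * (s * u * A)"
    using pos by (simp_all add: algebra_simps)
  show ?thesis
    \<comment> \<open>The differences are rewritten before the single terms occurring in them;
      otherwise they would no longer match.\<close>
    unfolding ts(3,4)
    unfolding ts(1,2) polygon_pair_def trace eigen_slopes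
    unfolding s_def[symmetric] u_def[symmetric]
    unfolding su eqs(3,4)
    unfolding eqs(1,2)
    unfolding cancel
    using pos by (simp add: zero_le_mult_iff mult.assoc)
qed

end

section \<open>Existence of the eigenvalue and conclusion\<close>

lemma rank_two_exists:
  assumes "b > 0" "c > 0" "b * c \<ge> 4"
  shows "\<exists>r. rank_two b c r"
proof -
  define t where "t = sqrt (real b) * sqrt (real c)"
  define e where "e = sqrt (t\<^sup>2 - 4)"
  \<comment> \<open>The larger root of \<open>r * r - t * r + 1 = 0\<close>; its discriminant
    \<open>t\<^sup>2 - 4\<close> is nonnegative because \<open>b * c \<ge> 4\<close>.\<close>
  define r where "r = (t + e) / 2"
  have "t\<^sup>2 = real (b * c)" by (simp add: t_def power_mult_distrib)
  with assms(3) have t4: "t\<^sup>2 \<ge> 2\<^sup>2" by (metis of_nat_le_iff of_nat_numeral power2_eq_square num_double numeral_times_numeral)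
  have "t \<ge> 0" by (simp add: t_def)
  then have t: "t \<ge> 2" using power2_le_imp_le[OF t4] by simp
  have e: "e \<ge> 0" "e * e = t * t - 4"
    using t4 by (simp_all add: e_def power2_eq_square)
  have r: "r \<ge> 1" using t e by (simp add: r_def)
  have "r * r + 1 = t * r" using e(2) by (simp add: r_def field_simps)
  then have "r + 1 / r = t" using r by (simp add: field_simps)
  with r assms show ?thesis by (auto simp: t_def intro!: exI[of _ r] rank_two.intro)
qed

theorem theorem1p2:
  fixes b c :: nat and l0 l1 :: int
  assumes "b > 0" and "c > 0" and "b * c \<ge> 4"
  shows "((real_of_int l0, real_of_int l1) \<notin> imaginary_cone b c \<longrightarrow>
           dominance_region b c (real_of_int l0, real_of_int l1) = {(real_of_int l0, real_of_int l1)}) \<and>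
         ((real_of_int l0, real_of_int l1) \<in> imaginary_cone b c \<longrightarrow>
           polytope (dominance_region b c (real_of_int l0, real_of_int l1)) \<and>
           dominance_region b c (real_of_int l0, real_of_int l1) =
           {(m0, m1).
              0 \<le> (real b * real c - disc_root b c) / (2 * real b) * (m0 - real_of_int l0)
                    + (m1 - real_of_int l1) \<and>
              (real b * real c - disc_root b c) / (2 * real b) * (m0 - real_of_int l0)
                    + (m1 - real_of_int l1)
                \<le> - real c * real_of_int l0
                    - (real b * real c + disc_root b c) / (2 * real b) * real b * real_of_int l1 \<and>

              0 \<le> - ((real b * real c - disc_root b c) / (2 * real b)) * (m0 - real_of_int l0)
                    + (m1 - real_of_int l1) \<and>
              - ((real b * real c - disc_root b c) / (2 * real b)) * (m0 - real_of_int l0)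
                    + (m1 - real_of_int l1)
                \<le> real c * real_of_int l0 \<and>

              0 \<le> - (m0 - real_of_int l0)
                    - (real b * real c - disc_root b c) / (2 * real c) * (m1 - real_of_int l1) \<and>
              - (m0 - real_of_int l0)
                    - (real b * real c - disc_root b c) / (2 * real c) * (m1 - real_of_int l1)
                \<le> (real b * real c + disc_root b c) / (2 * real c) * real c * real_of_int l0
                    + real b * real_of_int l1 \<and>

              0 \<le> - (m0 - real_of_int l0)
                    + (real b * real c - disc_root b c) / (2 * real c) * (m1 - real_of_int l1) \<and>
              - (m0 - real_of_int l0)
                    + (real b * real c - disc_root b c) / (2 * real c) * (m1 - real_of_int l1)
                \<le> - real b * real_of_int l1})"
proof -
  obtain r where "rank_two b c r" using rank_two_exists assms by blast
  then interpret rank_two b c r .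
  let ?l = "(real_of_int l0, real_of_int l1)"
  show ?thesis
  proof (intro conjI impI, goal_cases)
    case 1
    then show ?case
      by (intro dominance_region_outside_cone) (simp add: mem_imaginary_cone_iff)
  next
    case 2
    then show ?case
      by (intro polytope_dominance_region) (simp add: mem_imaginary_cone_iff)
  next
    case 3
    then have cone: "cone_pair r (tropical_seq b c ?l 0) (tropical_seq b c ?l 1)"
      by (simp add: mem_imaginary_cone_iff)
    show ?case
      by (intro set_eqI, unfold split_paired_all)
        (simp only: dominance_region_inside_cone[OF cone] polygon_pair_tropical_seq
          mem_Collect_eq case_prod_conv)
  qed
qed

end
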